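(* Let $(X,T)$ be a weakly mixing topological dynamical system. If for each nonempty open subset $U$ of $X$ there is $x\in U$ such that $N_T(x,U)=\{n\in\mathbb{Z}_+:T^nx\in U\}$ is a $C^*$-set, then $(X,T)$ is disjoint from all minimal systems.
   Context: A topological dynamical system (t.d.s.) is a pair $(X,T)$ where $X$ is a compact metric space and $T:X\to X$ is continuous and surjective. $\mathbb{Z}_+$ is the set of nonnegative integers. $(X,T)$ is transitive if for all nonempty open $U,V\subset X$ the set $\{n\in\mathbb{Z}_+:U\cap T^{-n}V\neq\emptyset\}$ is infinite; it is weakly mixing if $(X\times X,T\times T)$ is transitive; it is minimal (a minimal system) if for every $x\in X$ the orbit $\mathrm{orb}(x,T)=\{T^nx:n\in\mathbb{Z}_+\}$ is dense. A point $x$ is minimal if $(\overline{\mathrm{orb}(x,T)},T)$ is a minimal system. Points $x,y\in X$ are proximal if there is a sequence $\{n_i\}$ in $\mathbb{Z}_+$ with $\lim_i T^{n_i}x=\lim_i T^{n_i}y$. A set $Q\subset\mathbb{Z}_+$ is central if there exist a t.d.s. $(Z,R)$, a point $z\in Z$, a minimal point $w\in Z$ proximal to $z$, and a neighbourhood $W$ of $w$ such that $\{n\in\mathbb{Z}_+:R^nz\in W\}\subset Q$. A $C^*$-set is a subset of $\mathbb{Z}_+$ that has nonempty intersection with every central set. A joining of t.d.s. $(X,T)$ and $(Y,S)$ is a nonempty closed set $J\subset X\times Y$ with $(T\times S)(J)\subseteq J$ which projects onto $X$ and onto $Y$ under the coordinate projections; $(X,T)$ and $(Y,S)$ are disjoint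 if $X\times Y$ is their only joining. *)

theory Defs
  imports "HOL-Analysis.Analysis"
begin

text \<open>
  A system lives on a subset \<open>X\<close> of a metric space type, so that subsystems (orbit closures) and
  products stay within the same setting; only the values of \<open>T\<close> on \<open>X\<close> matter. The phase space
  is nonempty, as usual (otherwise \<open>X \<times> Y\<close> would be no joining at all for \<open>X = {}\<close>).
\<close>

definition tds :: "'a::metric_space set \<Rightarrow> ('a \<Rightarrow> 'a) \<Rightarrow> bool" where
  "tds X T \<longleftrightarrow> X \<noteq> {} \<and> compact X \<and> continuous_on X T \<and> T ` X = X"

definition transitive :: "'a::metric_space set \<Rightarrow> ('a \<Rightarrow> 'a) \<Rightarrow> bool" where
  "transitive X T \<longleftrightarrow>
     (\<forall>U V. openin (top_of_set X) U \<and> U \<noteq> {} \<and> openin (top_of_set X) V \<and> V \<noteq> {} \<longrightarrow>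
        infinite {n. U \<inter> (T ^^ n) -` V \<noteq> {}})"

definition weakly_mixing :: "'a::metric_space set \<Rightarrow> ('a \<Rightarrow> 'a) \<Rightarrow> bool" where
  "weakly_mixing X T \<longleftrightarrow> transitive (X \<times> X) (map_prod T T)"

definition orb :: "('a \<Rightarrow> 'a) \<Rightarrow> 'a \<Rightarrow> 'a set" where
  "orb T x = range (\<lambda>n. (T ^^ n) x)"

text \<open>Phase spaces are closed, so closure in the ambient type agrees with closure in \<open>X\<close>.\<close>

definition minimal_system :: "'a::metric_space set \<Rightarrow> ('a \<Rightarrow> 'a) \<Rightarrow> bool" where
  "minimal_system X T \<longleftrightarrow> tds X T \<and> (\<forall>x\<in>X. closure (orb T x) = X)"

definition minimal_point :: "'a::metric_space set \<Rightarrow> ('a \<Rightarrow> 'a) \<Rightarrow> 'a \<Rightarrow> bool" where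
  "minimal_point X T x \<longleftrightarrow> x \<in> X \<and> minimal_system (closure (orb T x)) T"

definition proximal :: "('a::metric_space \<Rightarrow> 'a) \<Rightarrow> 'a \<Rightarrow> 'a \<Rightarrow> bool" where
  "proximal T x y \<longleftrightarrow>
     (\<exists>(n :: nat \<Rightarrow> nat) l. (\<lambda>i. (T ^^ n i) x) \<longlonglongrightarrow> l \<and> (\<lambda>i. (T ^^ n i) y) \<longlonglongrightarrow> l)"

definition return_times :: "('a \<Rightarrow> 'a) \<Rightarrow> 'a \<Rightarrow> 'a set \<Rightarrow> nat set" where
  "return_times T x U = {n. (T ^^ n) x \<in> U}"

text \<open>
  \<open>Q\<close> is a central set, witnessed by the system \<open>(Z, R)\<close>, the points \<open>z\<close>, \<open>w\<close> and the
  (not necessarily open) neighbourhood \<open>W\<close> of \<open>w\<close> in \<open>Z\<close>.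
\<close>

definition central_witness ::
    "'a::metric_space set \<Rightarrow> ('a \<Rightarrow> 'a) \<Rightarrow> 'a \<Rightarrow> 'a \<Rightarrow> 'a set \<Rightarrow> nat set \<Rightarrow> bool" where
  "central_witness Z R z w W Q \<longleftrightarrow>
     tds Z R \<and> z \<in> Z \<and> minimal_point Z R w \<and> proximal R w z \<and>
     W \<subseteq> Z \<and> (\<exists>O'. openin (top_of_set Z) O' \<and> w \<in> O' \<and> O' \<subseteq> W) \<and>
     return_times R z W \<subseteq> Q"

text \<open>
  The definition of a central set quantifies existentially over all systems. HOL cannot quantify
  over types, so the systems range over the compact subsets of \<open>nat \<Rightarrow> real\<close> (with the product
  topology), which contain a homeomorphic copy of every compact metric space. Lemma
  \<open>central_witness_imp_central\<close> below shows that a witness in any metric space type whatsoever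
  yields a central set, so nothing is lost by this choice.
\<close>

definition central :: "nat set \<Rightarrow> bool" where
  "central Q \<longleftrightarrow>
     (\<exists>(Z :: (nat \<Rightarrow> real) set) R z w W. central_witness Z R z w W Q)"

definition C_star :: "nat set \<Rightarrow> bool" where
  "C_star A \<longleftrightarrow> (\<forall>Q. central Q \<longrightarrow> A \<inter> Q \<noteq> {})"

definition joining ::
    "'a::metric_space set \<Rightarrow> ('a \<Rightarrow> 'a) \<Rightarrow> 'b::metric_space set \<Rightarrow> ('b \<Rightarrow> 'b) \<Rightarrow> ('a \<times> 'b) set \<Rightarrow> bool"
where
  "joining X T Y S J \<longleftrightarrow>
     J \<noteq> {} \<and> closedin (top_of_set (X \<times> Y)) J \<and> map_prod T S ` J \<subseteq> J \<and>
     fst ` J = X \<and> snd ` J = Y"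

definition disjoint_systems ::
    "'a::metric_space set \<Rightarrow> ('a \<Rightarrow> 'a) \<Rightarrow> 'b::metric_space set \<Rightarrow> ('b \<Rightarrow> 'b) \<Rightarrow> bool" where
  "disjoint_systems X T Y S \<longleftrightarrow> (\<forall>J. joining X T Y S J \<longleftrightarrow> J = X \<times> Y)"


lemma compact_embeds_nat_real:
  fixes Z :: "'c::metric_space set"
  assumes "compact Z"
  obtains f :: "'c \<Rightarrow> nat \<Rightarrow> real" and g where "homeomorphism Z (f ` Z) f g"
proof (cases "Z = {}")
  case True
  then show ?thesis using that[of "\<lambda>_ _. 0"] by simp
next
  case False
  have "\<forall>e>0. \<exists>k. finite k \<and> k \<subseteq> Z \<and> Z \<subseteq> (\<Union>x\<in>k. ball x e)"
    using seq_compact_imp_totally_bounded[of Z] compact_imp_seq_compact[OF assms] by blast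
  then have "\<forall>m::nat. \<exists>k. finite k \<and> k \<subseteq> Z \<and> Z \<subseteq> (\<Union>x\<in>k. ball x (1 / Suc m))"
    by (metis divide_pos_pos of_nat_0_less_iff zero_less_Suc zero_less_one)
  then obtain k where k: "\<And>m. finite (k m)" "\<And>m. k m \<subseteq> Z"
      "\<And>m::nat. Z \<subseteq> (\<Union>x\<in>k m. ball x (1 / Suc m))"
    by metis
  define D where "D = (\<Union>m. k m)"
  have cD: "countable D" unfolding D_def using k(1) by (simp add: countable_finite)
  have "D \<noteq> {}" using k(3)[of 0] False unfolding D_def by auto
  then have D: "D = range (from_nat_into D)"
    using cD by (simp add: range_from_nat_into)
  define f where "f = (\<lambda>x n. dist x (from_nat_into D n))"
  have cont: "continuous_on Z f"
    unfolding f_def by (intro continuous_intros)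
  have inj: "inj_on f Z"
  proof (rule inj_onI)
    fix x y assume xy: "x \<in> Z" "y \<in> Z" "f x = f y"
    have eq: "dist x d = dist y d" if "d \<in> D" for d
      using xy(3) that D unfolding f_def by (metis (no_types, lifting) imageE)
    show "x = y"
    proof (rule ccontr)
      assume "x \<noteq> y"
      then obtain m where m: "1 / Suc m < dist x y / 2"
        using nat_approx_posE[of "dist x y / 2"] by auto
      obtain d where d: "d \<in> k m" "dist d x < 1 / Suc m" using k(3)[of m] xy(1) by auto
      have "dist x y \<le> dist x d + dist y d" by (metis dist_triangle2)
      also have "\<dots> = 2 * dist d x" using eq[of d] d(1) UN_I[of m UNIV d k] by (simp add: D_def dist_commute)
      finally show False using d(2) m by simp
    qed
  qed
  show ?thesis using homeomorphism_compact[OF assms cont refl inj] that by blast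
qed

lemma orb_subset:
  assumes "T ` X \<subseteq> X" "x \<in> X"
  shows "orb T x \<subseteq> X"
proof -
  have "(T ^^ n) x \<in> X" for n by (induction n) (use assms in auto)
  then show ?thesis by (auto simp: orb_def)
qed

lemma central_witness_imp_central:
  fixes Z :: "'c::metric_space set"
  assumes "central_witness Z R z w W Q"
  shows "central Q"
proof -
  from assms obtain O' n l where
    Z: "Z \<noteq> {}" "compact Z" "continuous_on Z R" "R ` Z = Z" and z: "z \<in> Z" and w: "w \<in> Z"
    and mw: "minimal_system (closure (orb R w)) R"
    and px: "(\<lambda>i. (R ^^ n i) w) \<longlonglongrightarrow> l" "(\<lambda>i. (R ^^ n i) z) \<longlonglongrightarrow> l"
    and W: "W \<subseteq> Z" "openin (top_of_set Z) O'" "w \<in> O'" "O' \<subseteq> W"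
    and Q: "return_times R z W \<subseteq> Q"
    unfolding central_witness_def tds_def minimal_point_def proximal_def by blast
  obtain f :: "'c \<Rightarrow> nat \<Rightarrow> real" and g where fg: "homeomorphism Z (f ` Z) f g"
    using compact_embeds_nat_real[OF Z(2)] by blast
  have gf: "g (f x) = x" if "x \<in> Z" for x using homeomorphism_apply1[OF fg that] .
  have cf: "continuous_on Z f" and cg: "continuous_on (f ` Z) g"
    using fg homeomorphism_cont1 homeomorphism_cont2 by blast+
  have gZ: "g ` f ` Z = Z" using homeomorphism_image2[OF fg] .
  define R' where "R' = f \<circ> R \<circ> g"
  have pZ: "(R ^^ i) x \<in> Z" if "x \<in> Z" for i x by (induction i) (use that Z(4) in auto)
  have conj: "(R' ^^ i) (f x) = f ((R ^^ i) x)" if "x \<in> Z" for i x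
    by (induction i) (simp_all add: R'_def gf pZ that)
  have tdsI: "continuous_on (f ` A) R'" "R' ` f ` A = f ` R ` A" if "A \<subseteq> Z" for A
  proof -
    have gA: "g ` f ` A = A" using gf that by (force simp: image_image)
    show "continuous_on (f ` A) R'" unfolding R'_def
      by (intro continuous_on_compose)
        (use that Z(3,4) gA in \<open>auto intro: continuous_on_subset[OF cg]
           continuous_on_subset[OF Z(3)] continuous_on_subset[OF cf]\<close>)
    show "R' ` f ` A = f ` R ` A" unfolding R'_def using gA by (metis image_comp)
  qed
  have orb: "orb R' (f x) = f ` orb R x" if "x \<in> Z" for x
    unfolding orb_def using conj[OF that] by (auto simp: image_image)
  have clo: "closure (orb R x) \<subseteq> Z" if "x \<in> Z" for x
    by (rule closure_minimal[OF orb_subset compact_imp_closed]) (use Z that in auto)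
  have cl: "closure (orb R' (f x)) = f ` closure (orb R x)" if "x \<in> Z" for x
  proof (rule antisym)
    have "compact (closure (orb R x))"
      by (metis Z(2) clo[OF that] closed_closure compact_Int_closed inf.absorb_iff2)
    then have "compact (f ` closure (orb R x))"
      using clo[OF that] cf by (meson compact_continuous_image continuous_on_subset)
    then show "closure (orb R' (f x)) \<subseteq> f ` closure (orb R x)"
      unfolding orb[OF that]
      by (intro closure_minimal compact_imp_closed) (auto simp: closure_subset image_mono)
    show "f ` closure (orb R x) \<subseteq> closure (orb R' (f x))"
      unfolding orb[OF that]
      by (rule image_closure_subset)
         (use continuous_on_subset[OF cf clo[OF that]] in \<open>auto simp: closure_subset\<close>)
  qed
  have tds: "tds (f ` Z) R'"
    unfolding tds_def using Z tdsI[of Z] compact_continuous_image[OF cf Z(2)] by auto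
  have min: "minimal_point (f ` Z) R' (f w)"
    unfolding minimal_point_def minimal_system_def tds_def cl[OF w]
  proof (intro conjI ballI)
    let ?K = "closure (orb R w)"
    have mw': "?K \<noteq> {}" "compact ?K" "R ` ?K = ?K" "\<And>x. x \<in> ?K \<Longrightarrow> closure (orb R x) = ?K"
      using mw unfolding minimal_system_def tds_def by auto
    show "f w \<in> f ` Z" using w by simp
    show "f ` ?K \<noteq> {}" using mw'(1) by simp
    show "compact (f ` ?K)"
      using mw'(2) clo[OF w] cf by (meson compact_continuous_image continuous_on_subset)
    show "continuous_on (f ` ?K) R'" using tdsI(1) clo[OF w] by blast
    show "R' ` f ` ?K = f ` ?K" using tdsI(2) clo[OF w] mw'(3) by metis
    fix y assume "y \<in> f ` ?K"
    then obtain x where "x \<in> ?K" "y = f x" by blast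
    then show "closure (orb R' y) = f ` ?K" using cl clo[OF w] mw'(4) by (metis subsetD)
  qed
  have "l \<in> Z"
    by (rule closed_sequentially[OF compact_imp_closed[OF Z(2)] _ px(1)]) (simp add: pZ w)
  have lim: "(\<lambda>i. (R' ^^ n i) (f x)) \<longlonglongrightarrow> f l" if "x \<in> Z" "(\<lambda>i. (R ^^ n i) x) \<longlonglongrightarrow> l" for x
    unfolding conj[OF that(1)]
    by (rule continuous_on_tendsto_compose[OF cf that(2) \<open>l \<in> Z\<close>]) (simp add: pZ that(1))
  have prox: "proximal R' (f w) (f z)"
    unfolding proximal_def using lim[OF w px(1)] lim[OF z px(2)] by blast
  have "return_times R' (f z) (f ` W) \<subseteq> return_times R z W"
    unfolding return_times_def using conj[OF z] gf pZ[OF z] W(1) by (auto, metis subsetD)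
  moreover have "openin (top_of_set (f ` Z)) (f ` O')"
    using homeomorphism_imp_open_map[OF fg W(2)] .
  ultimately have "central_witness (f ` Z) R' (f z) (f w) (f ` W) Q"
    unfolding central_witness_def using tds min prox z W Q by blast
  then show ?thesis unfolding central_def by blast
qed

end

theory Submission
  imports Defs
begin

text \<open>
  Let \<open>J\<close> be a joining, and suppose \<open>x \<in> U\<close> returns to \<open>U\<close> along a \<open>C\<^sup>*\<close>-set. Weak mixing makes the
  proximal cell of every point dense, and since \<open>Y\<close> is minimal this yields \<open>(x', y') \<in> J\<close> with
  \<open>y' \<in> V\<close> and \<open>x'\<close> proximal to \<open>x\<close>. Hence \<open>T\<^sup>m x\<close> and \<open>T\<^sup>m x'\<close> are close for a thick set of times
  \<open>m\<close>, and the return times of \<open>y'\<close> to \<open>V\<close> inside a thick set form a central set. So there is an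
  \<open>m\<close> with \<open>T\<^sup>m x \<in> U\<close>, \<open>T\<^sup>m x'\<close> close to \<open>T\<^sup>m x\<close> and \<open>S\<^sup>m y' \<in> V\<close>, and \<open>(T\<^sup>m x', S\<^sup>m y') \<in> J\<close>
  shows that \<open>J\<close> is dense.
\<close>

section \<open>Iterates of a continuous self-map\<close>

lemma funpow_mem:
  assumes "T ` X \<subseteq> X" "x \<in> X"
  shows "(T ^^ n) x \<in> X"
  using orb_subset[OF assms] by (auto simp: orb_def)

lemma funpow_image_eq:
  assumes "T ` X = X"
  shows "(T ^^ n) ` X = X"
proof (induction n)
  case (Suc n)
  have "(T ^^ Suc n) ` X = T ` (T ^^ n) ` X" by (simp add: image_comp)
  then show ?case using Suc assms by simp
qed simp

lemma continuous_on_funpow: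
  assumes "continuous_on X T" "T ` X \<subseteq> X"
  shows "continuous_on X (T ^^ n)"
proof (induction n)
  case (Suc n)
  have "(T ^^ n) ` X \<subseteq> X"
    using funpow_mem[OF assms(2)] by blast
  then have "continuous_on X (T \<circ> T ^^ n)"
    by (meson Suc assms(1) continuous_on_compose continuous_on_subset)
  then show ?case by simp
qed simp

lemma map_prod_funpow:
  fixes f :: "'a \<Rightarrow> 'a" and g :: "'b \<Rightarrow> 'b"
  shows "map_prod f g ^^ n = map_prod (f ^^ n) (g ^^ n)"
proof (induction n)
  case (Suc n)
  have "map_prod f g ^^ Suc n = map_prod f g \<circ> map_prod (f ^^ n) (g ^^ n)"
    by (simp only: funpow.simps Suc)
  then show ?case by (simp only: funpow.simps map_prod_compose)
qed (simp add: fun_eq_iff)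

lemma openin_funpow_vimage:
  assumes "continuous_on X T" "T ` X \<subseteq> X" "openin (top_of_set X) V"
  shows "openin (top_of_set X) (X \<inter> (T ^^ n) -` V)"
  using continuous_openin_preimage[OF continuous_on_funpow[OF assms(1,2)] _ assms(3)]
    funpow_mem[OF assms(2)] by blast

lemma openin_ball_subset:
  fixes X :: "'a::metric_space set"
  assumes "openin (top_of_set X) U" "x \<in> U"
  obtains e where "e > 0" "X \<inter> cball x e \<subseteq> U"
  using assms by (metis Int_commute openin_contains_cball)

text \<open>Puts \<open>X\<close> into the form in which \<open>Baire_category\<close> and
  \<open>Baire_category_alt\<close> are applied to it below.\<close>

lemma compact_imp_locally_compact_regular:
  fixes X :: "'a::metric_space set"
  assumes "compact X"
  shows "locally_compact_space (top_of_set X) \<and> regular_space (top_of_set X)"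
  using assms
  by (simp add: compact_imp_locally_compact_space compact_space_subtopology regular_space_euclidean
      regular_space_subtopology)

text \<open>Lets a limit coming from proximality be moved by a fixed time \<open>k\<close>.
  Closedness keeps \<open>l\<close> in \<open>X\<close>, where \<open>T ^^ k\<close> is known to be
  continuous.\<close>

lemma funpow_tendsto:
  fixes X :: "'a::metric_space set"
  assumes X: "compact X" "continuous_on X T" "T ` X \<subseteq> X"
    and z: "z \<in> X" "(\<lambda>i. (T ^^ n i) z) \<longlonglongrightarrow> l"
  shows "(\<lambda>i. (T ^^ (n i + k)) z) \<longlonglongrightarrow> (T ^^ k) l"
proof -
  have "l \<in> X"
    by (rule closed_sequentially[OF compact_imp_closed[OF X(1)] _ z(2)]) (simp add: funpow_mem X z(1))
  then have "(\<lambda>i. (T ^^ k) ((T ^^ n i) z)) \<longlonglongrightarrow> (T ^^ k) l"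
    by (rule continuous_on_tendsto_compose[OF continuous_on_funpow[OF X(2,3)] z(2)])
       (simp add: funpow_mem X z(1))
  then show ?thesis by (simp only: add.commute[of _ k] funpow_add comp_apply)
qed

section \<open>Weak mixing and hitting times\<close>

lemma weakly_mixing_common_time:
  assumes "weakly_mixing X T"
    and U: "openin (top_of_set X) U" "U \<noteq> {}" "openin (top_of_set X) U'" "U' \<noteq> {}"
    and V: "openin (top_of_set X) V" "V \<noteq> {}" "openin (top_of_set X) V'" "V' \<noteq> {}"
  obtains n where "U \<inter> (T ^^ n) -` U' \<noteq> {}" "V \<inter> (T ^^ n) -` V' \<noteq> {}"
proof -
  have "openin (top_of_set (X \<times> X)) (U \<times> V)" "openin (top_of_set (X \<times> X)) (U' \<times> V')"
    using U V by (auto intro: openin_Times)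
  moreover have "U \<times> V \<noteq> {}" "U' \<times> V' \<noteq> {}"
    using U V by auto
  ultimately have "infinite {n. U \<times> V \<inter> (map_prod T T ^^ n) -` (U' \<times> V') \<noteq> {}}"
    using assms(1) unfolding weakly_mixing_def transitive_def by blast
  then obtain n where "U \<times> V \<inter> (map_prod T T ^^ n) -` (U' \<times> V') \<noteq> {}"
    by (metis (mono_tags, lifting) Collect_empty_eq finite.emptyI)
  then have "U \<inter> (T ^^ n) -` U' \<noteq> {} \<and> V \<inter> (T ^^ n) -` V' \<noteq> {}"
    by (auto simp: map_prod_funpow)
  then show ?thesis
    using that by blast
qed

text \<open>Furstenberg's intersection lemma for hitting times, with one source \<open>U\<close> and
  finitely many targets. Each new target costs one shrinking of \<open>A\<close> and
  \<open>B\<close>.\<close>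

lemma weakly_mixing_hitting_subset:
  assumes wm: "weakly_mixing X T" and T: "continuous_on X T" "T ` X \<subseteq> X"
    and U: "openin (top_of_set X) U" "U \<noteq> {}"
    and \<W>: "finite \<W>" "\<And>W. W \<in> \<W> \<Longrightarrow> openin (top_of_set X) W \<and> W \<noteq> {}"
  shows "\<exists>A B. openin (top_of_set X) A \<and> A \<noteq> {} \<and> openin (top_of_set X) B \<and> B \<noteq> {} \<and>
    (\<forall>n. A \<inter> (T ^^ n) -` B \<noteq> {} \<longrightarrow> (\<forall>W\<in>\<W>. U \<inter> (T ^^ n) -` W \<noteq> {}))"
  using \<W>
proof (induction \<W>)
  case empty
  then show ?case using U by blast
next
  case (insert W \<W>)
  then obtain A B where A: "openin (top_of_set X) A" "A \<noteq> {}"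
    and B: "openin (top_of_set X) B" "B \<noteq> {}"
    and AB: "\<And>n W. A \<inter> (T ^^ n) -` B \<noteq> {} \<Longrightarrow> W \<in> \<W> \<Longrightarrow> U \<inter> (T ^^ n) -` W \<noteq> {}"
    by (metis insertCI)
  have W: "openin (top_of_set X) W" "W \<noteq> {}" using insert.prems by auto
  have X: "A \<subseteq> X" "B \<subseteq> X" using A B openin_imp_subset by blast+
  obtain k where k: "A \<inter> (T ^^ k) -` U \<noteq> {}" "B \<inter> (T ^^ k) -` W \<noteq> {}"
    using weakly_mixing_common_time[OF wm A U B W] .
  \<comment> \<open>If \<open>a\<close> in \<open>?A\<close> lands in \<open>?B\<close> at time
    \<open>n\<close>, then \<open>(T ^^ k) a\<close> lies in \<open>U\<close> and reaches
    \<open>W\<close> at time \<open>n\<close>, since iterates commute. The same \<open>a\<close>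
    still goes from \<open>A\<close> to \<open>B\<close>, which preserves the earlier
    targets.\<close>
  let ?A = "A \<inter> (X \<inter> (T ^^ k) -` U)" and ?B = "B \<inter> (X \<inter> (T ^^ k) -` W)"
  have "openin (top_of_set X) ?A" "openin (top_of_set X) ?B"
    by (intro openin_Int A B openin_funpow_vimage T U W)+
  moreover have "?A \<noteq> {}" "?B \<noteq> {}" using k X by blast+
  moreover have "U \<inter> (T ^^ n) -` W' \<noteq> {}"
    if n: "?A \<inter> (T ^^ n) -` ?B \<noteq> {}" and W': "W' \<in> insert W \<W>" for n W'
  proof -
    obtain a where a: "a \<in> A" "(T ^^ n) a \<in> B" "(T ^^ k) a \<in> U" "(T ^^ k) ((T ^^ n) a) \<in> W"
      using n by blast
    have "(T ^^ n) ((T ^^ k) a) \<in> W"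
      using a(4) by (metis add.commute comp_apply funpow_add)
    then show ?thesis using a AB W' by blast
  qed
  ultimately show ?case
    by (intro exI[of _ ?A] exI[of _ ?B]) simp
qed

text \<open>At a single time \<open>n\<close> the image of \<open>U\<close> meets every ball of a
  finite cover of radius \<open>e / 2\<close>. Whichever ball contains \<open>(T ^^ n) x\<close>
  also contains some \<open>(T ^^ n) u\<close>.\<close>

lemma weakly_mixing_hit_near:
  assumes wm: "weakly_mixing X T" and tds: "tds X T" and x: "x \<in> X"
    and U: "openin (top_of_set X) U" "U \<noteq> {}" and e: "e > 0"
  shows "\<exists>u\<in>U. \<exists>n. dist ((T ^^ n) x) ((T ^^ n) u) < e"
proof -
  have X: "compact X" "continuous_on X T" "T ` X \<subseteq> X" using tds unfolding tds_def by auto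
  obtain C where C: "C \<subseteq> X" "finite C" "X \<subseteq> (\<Union>c\<in>C. ball c (e / 2))"
    using compactE_image[OF X(1), of X "\<lambda>c. ball c (e / 2)"] e
    by (smt (verit) UN_iff centre_in_ball field_sum_of_halves open_ball subsetI)
  let ?\<W> = "(\<lambda>c. X \<inter> ball c (e / 2)) ` C"
  have "openin (top_of_set X) W \<and> W \<noteq> {}" if "W \<in> ?\<W>" for W
    using that C(1) e by (fastforce simp: openin_open_Int)
  then obtain A B where A: "openin (top_of_set X) A" "A \<noteq> {}"
    and B: "openin (top_of_set X) B" "B \<noteq> {}"
    and AB: "\<And>n W. A \<inter> (T ^^ n) -` B \<noteq> {} \<Longrightarrow> W \<in> ?\<W> \<Longrightarrow> U \<inter> (T ^^ n) -` W \<noteq> {}"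
    using weakly_mixing_hitting_subset[OF wm X(2,3) U, of ?\<W>] C(2)
    by (metis (no_types, lifting) finite_imageI)
  \<comment> \<open>Using the same pair twice reduces the two simultaneous hits to plain
    transitivity.\<close>
  obtain n where n: "A \<inter> (T ^^ n) -` B \<noteq> {}" "A \<inter> (T ^^ n) -` B \<noteq> {}"
    using weakly_mixing_common_time[OF wm A B A B] .
  obtain c where c: "c \<in> C" "dist c ((T ^^ n) x) < e / 2"
    using C(3) funpow_mem[OF X(3) x, of n] by auto
  obtain u where u: "u \<in> U" "dist c ((T ^^ n) u) < e / 2"
    using AB[OF n(1), of "X \<inter> ball c (e / 2)"] c(1) by auto
  have "dist ((T ^^ n) x) ((T ^^ n) u) < e"
    using c(2) u(2) by (metis dist_commute dist_triangle_half_l)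
  then show ?thesis using u(1) by blast
qed

section \<open>Density of proximal cells\<close>

lemma tendsto_close:
  fixes f g :: "'i \<Rightarrow> 'a::metric_space"
  assumes "((\<lambda>i. dist (f i) (g i)) \<longlongrightarrow> 0) F" "(f \<longlongrightarrow> l) F"
  shows "(g \<longlongrightarrow> l) F"
proof -
  have "((\<lambda>i. dist (f i) (g i) + dist (f i) l) \<longlongrightarrow> 0) F"
    using tendsto_add[OF assms(1) tendsto_dist[OF assms(2) tendsto_const[of l]]] by simp
  moreover have "dist (g i) l \<le> dist (f i) (g i) + dist (f i) l" for i
    by (metis dist_commute dist_triangle)
  ultimately have "((\<lambda>i. dist (g i) l) \<longlongrightarrow> 0) F"
    using tendsto_sandwich[of "\<lambda>_. 0" "\<lambda>i. dist (g i) l" F "\<lambda>i. dist (f i) (g i) + dist (f i) l" 0]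
    by simp
  then show ?thesis by (simp add: tendsto_dist_iff[of g])
qed

text \<open>Compactness makes the orbit of \<open>x\<close> converge along a subsequence of times at
  which the distances tend to 0, and the orbit of \<open>y\<close> then has the same limit.\<close>

lemma proximalI:
  assumes "compact X" "T ` X \<subseteq> X" "x \<in> X" "y \<in> X"
    and "\<And>e. e > 0 \<Longrightarrow> \<exists>n. dist ((T ^^ n) x) ((T ^^ n) y) < e"
  shows "proximal T x y"
proof -
  have "\<exists>n. dist ((T ^^ n) x) ((T ^^ n) y) < inverse (real (Suc i))" for i
    by (rule assms(5)) simp
  then obtain n where n: "\<And>i. dist ((T ^^ n i) x) ((T ^^ n i) y) < inverse (real (Suc i))"
    by metis
  obtain l r where r: "strict_mono (r :: nat \<Rightarrow> nat)" and l: "((\<lambda>i. (T ^^ n i) x) \<circ> r) \<longlonglongrightarrow> l"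
    using assms(1) funpow_mem[OF assms(2,3)] unfolding compact_def by (metis (no_types, lifting))
  have "(\<lambda>i. dist ((T ^^ n i) x) ((T ^^ n i) y)) \<longlonglongrightarrow> 0"
    by (rule tendsto_sandwich[OF _ _ tendsto_const LIMSEQ_inverse_real_of_nat])
       (use n in \<open>auto intro!: always_eventually less_imp_le\<close>)
  then have "(\<lambda>i. dist ((T ^^ n (r i)) x) ((T ^^ n (r i)) y)) \<longlonglongrightarrow> 0"
    using LIMSEQ_subseq_LIMSEQ[OF _ r] by (force simp: comp_def)
  then have "(\<lambda>i. (T ^^ n (r i)) y) \<longlonglongrightarrow> l"
    using l unfolding comp_def by (rule tendsto_close)
  moreover have "(\<lambda>i. (T ^^ n (r i)) x) \<longlonglongrightarrow> l"
    using l unfolding comp_def .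
  ultimately show ?thesis
    unfolding proximal_def by (intro exI[of _ "\<lambda>i. n (r i)"] exI[of _ l] conjI)
qed

text \<open>Baire category: the sets \<open>D i\<close> of points that come within
  \<open>inverse (real (Suc i))\<close> of \<open>x\<close> at some common time are open, and dense
  by \<open>weakly_mixing_hit_near\<close>. Points in all of them are proximal to
  \<open>x\<close>.\<close>

lemma weakly_mixing_proximal_dense:
  assumes wm: "weakly_mixing X T" and tds: "tds X T" and x: "x \<in> X"
    and U: "openin (top_of_set X) U" "U \<noteq> {}"
  shows "\<exists>u\<in>U. proximal T x u"
proof -
  have X: "compact X" "continuous_on X T" "T ` X \<subseteq> X" using tds unfolding tds_def by auto
  define D where "D i = (\<Union>n. X \<inter> (T ^^ n) -` (X \<inter> ball ((T ^^ n) x) (inverse (real (Suc i)))))"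
    for i
  have open_D: "openin (top_of_set X) (D i)" for i
    unfolding D_def
    by (intro openin_Union, elim imageE, hypsubst) (intro openin_funpow_vimage X(2,3) openin_open_Int open_ball)
  have dense_D: "top_of_set X closure_of D i = topspace (top_of_set X)" for i
  proof -
    have "D i \<inter> V \<noteq> {}" if V: "openin (top_of_set X) V" "V \<noteq> {}" for V
    proof -
      obtain u n where u: "u \<in> V" "dist ((T ^^ n) x) ((T ^^ n) u) < inverse (real (Suc i))"
        using weakly_mixing_hit_near[OF wm tds x V, of "inverse (real (Suc i))"] by auto
      have "u \<in> X" using u(1) V(1) openin_imp_subset by blast
      then have "u \<in> D i" unfolding D_def using u(2) funpow_mem[OF X(3)] by auto
      then show ?thesis using u(1) by blast
    qed
    then show ?thesis unfolding dense_intersects_open by (simp add: Int_commute)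
  qed
  have "locally_compact_space (top_of_set X) \<and> regular_space (top_of_set X)"
    using X(1) by (rule compact_imp_locally_compact_regular)
  then have "top_of_set X closure_of \<Inter>(range D) = topspace (top_of_set X)"
    by (intro Baire_category) (use open_D dense_D in auto)
  then have "\<Inter>(range D) \<inter> U \<noteq> {}"
    using U unfolding dense_intersects_open by (metis Int_commute)
  then obtain u where u: "u \<in> U" "\<And>i. u \<in> D i" by blast
  have "\<exists>n. dist ((T ^^ n) x) ((T ^^ n) u) < e" if "e > 0" for e
  proof -
    obtain i where "inverse (real (Suc i)) < e" using reals_Archimedean[OF \<open>e > 0\<close>] by blast
    moreover obtain n where "dist ((T ^^ n) x) ((T ^^ n) u) < inverse (real (Suc i))"
      using u(2)[of i] unfolding D_def by auto
    ultimately show ?thesis by (meson order.strict_trans)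
  qed
  moreover have "u \<in> X" using u(1) U(1) openin_imp_subset by blast
  ultimately have "proximal T x u" using proximalI[OF X(1,3) x] by blast
  then show ?thesis using u(1) by blast
qed

section \<open>Proximality under iteration, and thick sets\<close>

lemma proximal_funpow:
  assumes X: "compact X" "continuous_on X T" "T ` X \<subseteq> X" and "x \<in> X" "y \<in> X" "proximal T x y"
  shows "proximal T ((T ^^ k) x) ((T ^^ k) y)"
proof -
  obtain n l where l: "(\<lambda>i. (T ^^ n i) x) \<longlonglongrightarrow> l" "(\<lambda>i. (T ^^ n i) y) \<longlonglongrightarrow> l"
    using assms(6) unfolding proximal_def by blast
  have "(\<lambda>i. (T ^^ n i) ((T ^^ k) z)) \<longlonglongrightarrow> (T ^^ k) l" if "z \<in> X" "(\<lambda>i. (T ^^ n i) z) \<longlonglongrightarrow> l" for z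
    using funpow_tendsto[OF X that, of k] by (simp only: funpow_add comp_apply)
  then show ?thesis using l assms(4,5) unfolding proximal_def by blast
qed

definition thick :: "nat set \<Rightarrow> bool" where
  "thick H \<longleftrightarrow> (\<forall>L. \<exists>n. \<forall>k\<le>L. n + k \<in> H)"

text \<open>If the orbits share a limit along \<open>n i\<close>, they also do along
  \<open>n i + k\<close> for each fixed \<open>k\<close>. For the finitely many
  \<open>k \<le> L\<close>, closeness eventually holds simultaneously.\<close>

lemma proximal_thick:
  assumes X: "compact X" "continuous_on X T" "T ` X \<subseteq> X" and xy: "x \<in> X" "y \<in> X" "proximal T x y"
    and e: "e > 0"
  shows "thick {m. dist ((T ^^ m) x) ((T ^^ m) y) < e}"
  unfolding thick_def
proof
  fix L
  obtain n l where l: "(\<lambda>i. (T ^^ n i) x) \<longlonglongrightarrow> l" "(\<lambda>i. (T ^^ n i) y) \<longlonglongrightarrow> l"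
    using xy(3) unfolding proximal_def by blast
  have "\<forall>\<^sub>F i in sequentially. dist ((T ^^ (n i + k)) x) ((T ^^ (n i + k)) y) < e" for k
    using tendsto_dist[OF funpow_tendsto[OF X xy(1) l(1)] funpow_tendsto[OF X xy(2) l(2)], of k k] e
    by (simp add: order_tendstoD(2))
  then have "\<forall>\<^sub>F i in sequentially. \<forall>k\<in>{..L}. dist ((T ^^ (n i + k)) x) ((T ^^ (n i + k)) y) < e"
    by (intro eventually_ball_finite) auto
  then show "\<exists>n. \<forall>k\<le>L. n + k \<in> {m. dist ((T ^^ m) x) ((T ^^ m) y) < e}"
    by (auto dest!: eventually_happens)
qed

section \<open>Central sets from thick sets\<close>

lemma tendsto_fun_componentwise:
  fixes f :: "'c \<Rightarrow> 'i \<Rightarrow> 'd::topological_space"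
  assumes "\<And>k. ((\<lambda>i. f i k) \<longlongrightarrow> l k) F"
  shows "(f \<longlongrightarrow> l) F"
proof -
  have "limitin (product_topology (\<lambda>_. euclidean) UNIV) f l F"
    unfolding limitin_componentwise using assms by simp
  then show ?thesis by (simp add: euclidean_product_topology)
qed

text \<open>Tychonoff's theorem for function types, used for the phase space of the shift.\<close>

lemma compact_Pi_UNIV:
  fixes K :: "'i \<Rightarrow> 'd::topological_space set"
  assumes "\<And>i. compact (K i)"
  shows "compact (Pi UNIV K)"
proof -
  have "compactin (product_topology (\<lambda>_. euclidean) UNIV) (PiE UNIV K)"
    unfolding compactin_PiE using assms by simp
  then show ?thesis by (simp add: euclidean_product_topology PiE_UNIV_domain)
qed

text \<open>
  The indicator of the complement of \<open>H\<close>, as a point of a full shift, is proximal to the fixed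
  point \<open>0\<close>. Pairing it with \<open>y\<close> realises the set of return times inside \<open>H\<close>.
\<close>

lemma central_thick_Int_return_times:
  fixes Y :: "'b::metric_space set"
  assumes min: "minimal_system Y S" and y: "y \<in> V" and V: "openin (top_of_set Y) V"
    and H: "thick H"
  shows "central (H \<inter> return_times S y V)"
proof -
  have Y: "Y \<noteq> {}" "compact Y" "continuous_on Y S" "S ` Y = Y"
    and cl: "\<And>y. y \<in> Y \<Longrightarrow> closure (orb S y) = Y"
    using min unfolding minimal_system_def tds_def by auto
  have yY: "y \<in> Y" using y V openin_imp_subset by blast
  define \<sigma> where "\<sigma> = (\<lambda>(\<psi> :: nat \<Rightarrow> real) k. \<psi> (Suc k))"
  define K :: "(nat \<Rightarrow> real) set" where "K = Pi UNIV (\<lambda>_. {0..1})"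
  define R where "R = map_prod \<sigma> S"
  define o' :: "nat \<Rightarrow> real" where "o' = (\<lambda>_. 0)"
  define \<phi> :: "nat \<Rightarrow> real" where "\<phi> = indicator (- H)"
  \<comment> \<open>The coordinates of \<open>\<phi>\<close> are 0 or 1, so being below 1 at
    position 0 after \<open>n\<close> shifts means exactly that \<open>n\<close> lies in
    \<open>H\<close>.\<close>
  define W where "W = (K \<inter> (\<lambda>\<psi>. \<psi> 0) -` {..<1}) \<times> V"
  have \<sigma>_pow: "(\<sigma> ^^ n) \<psi> = (\<lambda>k. \<psi> (n + k))" for n \<psi>
    by (induction n arbitrary: \<psi>) (auto simp: \<sigma>_def)
  have \<sigma>o: "(\<sigma> ^^ n) o' = o'" for n
    by (simp add: \<sigma>_pow o'_def)
  have R_pow: "(R ^^ n) (\<psi>, v) = ((\<sigma> ^^ n) \<psi>, (S ^^ n) v)" for n \<psi> v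
    by (simp add: R_def map_prod_funpow)
  have oK: "o' \<in> K" "\<phi> \<in> K" by (auto simp: K_def o'_def \<phi>_def indicator_def)
  have \<sigma>_cont: "continuous_on A \<sigma>" for A
    unfolding \<sigma>_def
    by (intro continuous_on_coordinatewise_then_product
        continuous_on_subset[OF continuous_on_product_coordinates subset_UNIV])
  have R_cont: "continuous_on (A \<times> Y) R" for A
    unfolding R_def map_prod_def case_prod_beta
    by (intro continuous_on_Pair continuous_on_compose2[OF \<sigma>_cont[of UNIV]]
        continuous_on_compose2[OF Y(3)] continuous_on_fst continuous_on_snd continuous_on_id) auto
  have "\<sigma> ` K = K"
  proof
    show "\<sigma> ` K \<subseteq> K" by (auto simp: \<sigma>_def K_def)
    show "K \<subseteq> \<sigma> ` K"
    proof
      fix \<psi> assume "\<psi> \<in> K"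
      \<comment> \<open>Prepending a 0 gives a preimage under the one-sided shift.\<close>
      then have "case_nat 0 \<psi> \<in> K" by (simp add: K_def Pi_iff split: nat.split)
      moreover have "\<sigma> (case_nat 0 \<psi>) = \<psi>" by (simp add: \<sigma>_def)
      ultimately show "\<psi> \<in> \<sigma> ` K" by (metis imageI)
    qed
  qed
  then have tds: "tds (K \<times> Y) R"
    unfolding tds_def using Y oK R_cont compact_Pi_UNIV[of "\<lambda>_. {0..1::real}"]
    by (auto simp: R_def K_def map_prod_surj_on intro: compact_Times)
  \<comment> \<open>Over the fixed point \<open>o'\<close> the product system is a copy of
    \<open>Y\<close>, from which it inherits minimality.\<close>
  have orb: "closure (orb R (o', v)) = {o'} \<times> Y" if "v \<in> Y" for v
  proof -
    have "orb R (o', v) = {o'} \<times> orb S v" by (auto simp: orb_def R_pow \<sigma>o)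
    then show ?thesis using cl[OF that] by (simp add: closure_Times)
  qed
  have "tds ({o'} \<times> Y) R"
  proof -
    have "\<sigma> o' = o'" using \<sigma>o[of 1] by simp
    then show ?thesis
      unfolding tds_def using Y R_cont by (auto simp: R_def map_prod_surj_on intro: compact_Times)
  qed
  then have mp: "minimal_point (K \<times> Y) R (o', y)"
    unfolding minimal_point_def minimal_system_def using oK yY orb by auto
  have prox: "proximal R (o', y) (\<phi>, y)"
  proof -
    \<comment> \<open>From \<open>n L\<close> on, \<open>H\<close> contains a block of length
      \<open>L + 1\<close>, so \<open>\<phi>\<close> shifted by \<open>n L\<close> vanishes at
      positions 0 to \<open>L\<close>. Passing to the subsequence \<open>r\<close> makes the second
      coordinate, shared by both points, converge.\<close>
    obtain n where n: "\<And>L k. k \<le> L \<Longrightarrow> n L + k \<in> H" using H unfolding thick_def by metis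
    obtain l r where r: "strict_mono (r :: nat \<Rightarrow> nat)" and l: "((\<lambda>i. (S ^^ n i) y) \<circ> r) \<longlonglongrightarrow> l"
      using Y(2) funpow_mem[of S Y y] Y(4) yY unfolding compact_def
      by (metis (no_types, lifting) order_refl)
    have "(\<lambda>i. (\<sigma> ^^ n (r i)) \<phi>) \<longlonglongrightarrow> o'"
    proof (rule tendsto_fun_componentwise)
      fix k
      have "\<forall>\<^sub>F i in sequentially. (\<sigma> ^^ n (r i)) \<phi> k = o' k"
        using eventually_ge_at_top[of k]
      proof eventually_elim
        case (elim i)
        \<comment> \<open>As \<open>k \<le> i \<le> r i\<close>, position \<open>k\<close> falls
          inside the block starting at \<open>n (r i)\<close>.\<close>
        then have "k \<le> r i" using seq_suble[OF r, of i] by simp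
        then show ?case using n by (simp add: \<sigma>_pow \<phi>_def o'_def)
      qed
      then show "(\<lambda>i. (\<sigma> ^^ n (r i)) \<phi> k) \<longlonglongrightarrow> o' k" by (rule tendsto_eventually)
    qed
    then have "(\<lambda>i. (R ^^ n (r i)) (\<phi>, y)) \<longlonglongrightarrow> (o', l)" "(\<lambda>i. (R ^^ n (r i)) (o', y)) \<longlonglongrightarrow> (o', l)"
      using l by (auto simp: R_pow \<sigma>o comp_def intro: tendsto_Pair)
    then show ?thesis
      unfolding proximal_def by (intro exI[of _ "\<lambda>i. n (r i)"] exI[of _ "(o', l)"] conjI)
  qed
  have "openin (top_of_set (K \<times> Y)) W"
    unfolding W_def
    by (intro openin_Times V continuous_openin_preimage_gen
        continuous_on_subset[OF continuous_on_product_coordinates]) auto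
  moreover have "(o', y) \<in> W" using oK y by (auto simp: W_def o'_def)
  moreover have "W \<subseteq> K \<times> Y" using openin_imp_subset[OF V] by (auto simp: W_def)
  moreover have "return_times R (\<phi>, y) W \<subseteq> H \<inter> return_times S y V"
    by (auto simp: return_times_def R_pow W_def \<sigma>_pow \<phi>_def indicator_def split: if_splits)
  ultimately have "central_witness (K \<times> Y) R (\<phi>, y) (o', y) W (H \<inter> return_times S y V)"
    unfolding central_witness_def using tds mp prox oK yY by blast
  then show ?thesis by (rule central_witness_imp_central)
qed

section \<open>Joinings with a minimal system\<close>

lemma minimal_hits_open:
  assumes "minimal_system Y S" "y \<in> Y" "openin (top_of_set Y) V" "V \<noteq> {}"
  shows "\<exists>n. (S ^^ n) y \<in> V"
proof -
  obtain G where G: "open G" "V = Y \<inter> G" using assms(3) openin_open by metis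
  have "closure (orb S y) = Y" "S ` Y \<subseteq> Y"
    using assms(1,2) unfolding minimal_system_def tds_def by auto
  moreover have "orb S y \<inter> G \<noteq> {}"
    using G assms(4) calculation open_Int_closure_eq_empty[OF G(1), of "orb S y"] by blast
  ultimately show ?thesis using G funpow_mem[of S Y y] assms(2) unfolding orb_def by blast
qed

text \<open>Points whose fibre in \<open>J\<close> meets a ball inside \<open>V\<close> form a
  closed set \<open>A\<close>. Minimality of \<open>Y\<close> makes the preimages of
  \<open>A\<close> under iterates cover \<open>X\<close>, so one has interior by Baire and meets any
  prescribed proximal cell.\<close>

lemma joining_proximal_fibre:
  assumes wm: "weakly_mixing X T" and tds: "tds X T" and min: "minimal_system Y S"
    and J: "joining X T Y S J" and x: "x \<in> X" and V: "openin (top_of_set Y) V" "V \<noteq> {}"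
  shows "\<exists>x' y'. (x', y') \<in> J \<and> y' \<in> V \<and> proximal T x x'"
proof -
  have X: "X \<noteq> {}" "compact X" "continuous_on X T" "T ` X = X"
    using tds unfolding tds_def by auto
  have Y: "compact Y" "continuous_on Y S" "S ` Y = Y"
    using min unfolding minimal_system_def tds_def by auto
  have J': "map_prod T S ` J \<subseteq> J" "fst ` J = X" "snd ` J = Y" "J \<subseteq> X \<times> Y"
    using J closedin_imp_subset unfolding joining_def by blast+
  have "closedin (top_of_set (X \<times> Y)) J" using J unfolding joining_def by blast
  then have "compact J" using closedin_compact compact_Times[OF X(2) Y(1)] by blast
  obtain v where v: "v \<in> V" using V by blast
  \<comment> \<open>A closed ball makes \<open>A\<close> compact, hence each \<open>C n\<close>
    closed.\<close>
  obtain e where e: "e > 0" "Y \<inter> cball v e \<subseteq> V" using openin_ball_subset[OF V(1) v] .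
  define A where "A = fst ` (J \<inter> UNIV \<times> cball v e)"
  have "compact A" unfolding A_def
    using \<open>compact J\<close> by (intro compact_continuous_image compact_Int_closed closed_Times continuous_on_fst continuous_on_id) auto
  then have A: "closedin (top_of_set X) A"
    by (intro closed_subset compact_imp_closed) (use J'(2) in \<open>auto simp: A_def\<close>)
  define C where "C n = X \<inter> (T ^^ n) -` A" for n
  have closed_C: "closedin (top_of_set X) (C n)" for n
    unfolding C_def
    using continuous_closedin_preimage_gen continuous_on_funpow[OF X(3)] A
    by (metis (no_types, lifting) X(4) Pi_I' continuous_on_closed_gen dual_order.refl funpow_mem)
  have "X \<subseteq> \<Union>(range C)"
  proof
    fix u assume "u \<in> X"
    then obtain p where p: "p \<in> J" "u = fst p" using J'(2) by (metis imageE)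
    define w where "w = snd p"
    have w: "(u, w) \<in> J" "w \<in> Y" using p J'(3) unfolding w_def by auto
    \<comment> \<open>Minimality drives \<open>w\<close> into the ball, and invariance of
      \<open>J\<close> keeps the pair of iterates in \<open>J\<close>.\<close>
    have "openin (top_of_set Y) (Y \<inter> ball v e)" "v \<in> Y \<inter> ball v e"
      using v e(1) openin_imp_subset[OF V(1)] by (auto simp: openin_open_Int)
    then obtain n where "(S ^^ n) w \<in> ball v e" using minimal_hits_open[OF min w(2)] by (metis IntD2 emptyE)
    moreover have "((T ^^ n) u, (S ^^ n) w) \<in> J"
      using funpow_mem[OF J'(1) w(1), of n] by (simp add: map_prod_funpow)
    ultimately have "(T ^^ n) u \<in> A" unfolding A_def by (intro image_eqI[of _ _ "((T ^^ n) u, (S ^^ n) w)"]) auto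
    then show "u \<in> \<Union>(range C)" using \<open>u \<in> X\<close> unfolding C_def by blast
  qed
  then have UC: "\<Union>(range C) = X" unfolding C_def by blast
  have "locally_compact_space (top_of_set X) \<and> regular_space (top_of_set X)"
    using X(2) by (rule compact_imp_locally_compact_regular)
  then have "top_of_set X interior_of \<Union>(range C) = {}" if "\<And>n. top_of_set X interior_of C n = {}"
    using closed_C that by (intro Baire_category_alt) auto
  moreover have "top_of_set X interior_of \<Union>(range C) \<noteq> {}"
    using UC X(1) interior_of_topspace[of "top_of_set X"] by simp
  ultimately have "\<exists>n. top_of_set X interior_of C n \<noteq> {}" by blast
  then obtain n where n: "top_of_set X interior_of C n \<noteq> {}" by blast
  \<comment> \<open>It is the fibre over \<open>(T ^^ n) u\<close>, not over \<open>u\<close>, that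
    meets the ball. Hence \<open>u\<close> is taken proximal to an \<open>n\<close>-th preimage of
    \<open>x\<close>, and applying \<open>T ^^ n\<close> returns to \<open>x\<close>.\<close>
  obtain x0 where x0: "x0 \<in> X" "(T ^^ n) x0 = x" 
    using funpow_image_eq[OF X(4), of n] x by (metis imageE)
  obtain u where u: "u \<in> top_of_set X interior_of C n" "proximal T x0 u"
    using weakly_mixing_proximal_dense[OF wm tds x0(1) _ n] by auto
  have uC: "u \<in> C n" using interior_of_subset[of "top_of_set X" "C n"] u(1) by blast
  then have "u \<in> X" "(T ^^ n) u \<in> A" unfolding C_def by auto
  then obtain y' where y': "((T ^^ n) u, y') \<in> J" "y' \<in> cball v e" unfolding A_def by auto
  have "y' \<in> V" using y' J'(4) e(2) by blast
  moreover have "proximal T x ((T ^^ n) u)"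
    using proximal_funpow[OF X(2,3) _ x0(1) \<open>u \<in> X\<close> u(2), of n] x0(2) X(4) by simp
  ultimately show ?thesis using y'(1) by blast
qed

theorem proposition1p4:
  fixes X :: "'a::metric_space set" and T :: "'a \<Rightarrow> 'a"
    and Y :: "'b::metric_space set" and S :: "'b \<Rightarrow> 'b"
  assumes "tds X T" and "weakly_mixing X T"
    and "\<And>U. openin (top_of_set X) U \<Longrightarrow> U \<noteq> {} \<Longrightarrow> \<exists>x\<in>U. C_star (return_times T x U)"
    and "minimal_system Y S"
  shows "disjoint_systems X T Y S"
  unfolding disjoint_systems_def
proof (intro allI iffI)
  have X: "X \<noteq> {}" "compact X" "continuous_on X T" "T ` X = X"
    using assms(1) unfolding tds_def by auto
  have Y: "Y \<noteq> {}" "S ` Y = Y"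
    using assms(4) unfolding minimal_system_def tds_def by auto
  fix J
  show "joining X T Y S J" if "J = X \<times> Y"
    unfolding joining_def that using X Y by (auto simp: map_prod_surj_on)
  assume J: "joining X T Y S J"
  then have J': "map_prod T S ` J \<subseteq> J" "J \<subseteq> X \<times> Y" "closedin (top_of_set (X \<times> Y)) J"
    using closedin_imp_subset unfolding joining_def by blast+
  show "J = X \<times> Y"
  proof (rule ccontr)
    assume "J \<noteq> X \<times> Y"
    then obtain a b where ab: "a \<in> X" "b \<in> Y" "(a, b) \<notin> J" using J'(2) by auto
    have "openin (top_of_set (X \<times> Y)) (X \<times> Y - J)" "(a, b) \<in> X \<times> Y - J"
      using J'(3) ab by (simp_all add: openin_diff)
    \<comment> \<open>An open box missing \<open>J\<close>; the contradiction will be a point of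
      \<open>J\<close> inside it.\<close>
    then obtain U V where U: "openin (top_of_set X) U" "a \<in> U"
      and V: "openin (top_of_set Y) V" "b \<in> V" and UV: "U \<times> V \<subseteq> X \<times> Y - J"
      by (metis Times_in_interior_subtopology)
    obtain e where e: "e > 0" "X \<inter> cball a e \<subseteq> U" using openin_ball_subset[OF U] .
    \<comment> \<open>Half the radius is spent on the return of \<open>x\<close> near
      \<open>a\<close>, the other half on the distance between the orbits of \<open>x\<close> and
      \<open>x'\<close>.\<close>
    let ?B = "X \<inter> ball a (e / 2)"
    have "openin (top_of_set X) ?B" "?B \<noteq> {}" using ab e(1) by (auto simp: openin_open_Int)
    then obtain x where x: "x \<in> ?B" "C_star (return_times T x ?B)" using assms(3) by blast
    obtain x' y' where x': "(x', y') \<in> J" "y' \<in> V" "proximal T x x'"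
      using joining_proximal_fibre[OF assms(2,1,4) J _ V(1)] x(1) V(2) by blast
    have x'X: "x' \<in> X" using x'(1) J'(2) by blast
    let ?H = "{m. dist ((T ^^ m) x) ((T ^^ m) x') < e / 2}"
    have "thick ?H" using proximal_thick[OF X(2,3) _ _ x'X x'(3), of "e / 2"] X(4) x(1) e(1) by auto
    then have "central (?H \<inter> return_times S y' V)"
      using central_thick_Int_return_times[OF assms(4) x'(2) V(1)] by blast
    \<comment> \<open>The \<open>C_star\<close> set of returns of \<open>x\<close> meets this
      central set, so one time serves all three conditions.\<close>
    then obtain m where m: "m \<in> return_times T x ?B" "m \<in> ?H" "m \<in> return_times S y' V"
      using x(2) unfolding C_star_def by blast
    have "dist a ((T ^^ m) x) < e / 2" "dist ((T ^^ m) x) ((T ^^ m) x') < e / 2"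
      using m(1,2) by (auto simp: return_times_def)
    then have "dist a ((T ^^ m) x') < e"
      using dist_triangle[of a "(T ^^ m) x'" "(T ^^ m) x"] by simp
    moreover have "(T ^^ m) x' \<in> X" using funpow_mem[of T X] X(4) x'X by blast
    ultimately have "(T ^^ m) x' \<in> U" using e(2) by auto
    moreover have "(S ^^ m) y' \<in> V" using m(3) by (simp add: return_times_def)
    moreover have "((T ^^ m) x', (S ^^ m) y') \<in> J"
      using funpow_mem[OF J'(1) x'(1), of m] by (simp add: map_prod_funpow)
    ultimately show False using UV by blast
  qed
qed

end
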